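(* Let $\mathbf{H}\in\mathbb{R}^{2\times 2}$ have singular values $\sigma_1\ge\sigma_2\ge 0$, and let $\mathbf{Z}$ be a standard normal vector in $\mathbb{R}^2$ independent of the input $\mathbf{X}$. Then $$\max_{P_{\mathbf{X}}:\ \|\mathbf{X}\|\le 1} I(\mathbf{X};\mathbf{H}\mathbf{X}+\mathbf{Z}) \;=\; \mathsf{C}(\sigma_1,\sigma_2),$$ where $$\mathsf{C}(r_p,r_m)=\max_{P_{\mathbf{X}}:\ \mathbf{X}\in\mathcal{E}(r_p,r_m)} I(\mathbf{X};\mathbf{X}+\mathbf{Z}).$$
   Context: $\|\cdot\|$ is the Euclidean norm and $I(\cdot;\cdot)$ is mutual information. For $r_p\ge r_m\ge 0$, $\mathcal{E}(r_p,r_m)=\{(x_1,x_2)\in\mathbb{R}^2: x_1^2/r_p^2+x_2^2/r_m^2\le 1\}$, with the convention that a zero radius forces the corresponding coordinate to be $0$. The constraint $\mathbf{X}\in A$ (or $\|\mathbf{X}\|\le 1$) means that it holds almost surely. The maxima are over Borel probability distributions $P_{\mathbf{X}}$ on $\mathbb{R}^2$ satisfying the constraint. *)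

theory Defs
  imports "HOL-Probability.Probability"
begin

definition std_normal_vec :: "(real ^ 'n) measure" where
  "std_normal_vec = density lborel (\<lambda>z. ennreal (\<Prod>i\<in>UNIV. std_normal_density (z $ i)))"

text \<open>
  The mutual information \<open>I(X; f(X) + Z)\<close>, to logarithm base \<open>b\<close>, for \<open>X\<close> distributed
  according to \<open>P\<close> and an independent standard normal vector \<open>Z\<close>, realised on the product of
  \<open>P\<close> with the law of \<open>Z\<close>. Lemma \<open>mutual_information_eq_awgn_information\<close> below shows
  that every other realisation gives the same value.
\<close>

definition awgn_information ::
  "real \<Rightarrow> (real ^ 'n \<Rightarrow> real ^ 'n) \<Rightarrow> (real ^ 'n) measure \<Rightarrow> real" where
  "awgn_information b f P =
     prob_space.mutual_information (P \<Otimes>\<^sub>M std_normal_vec) b borel borel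
       (\<lambda>(x, z). x) (\<lambda>(x, z). f x + z)"

lemma sets_std_normal_vec [simp, measurable_cong]: "sets std_normal_vec = sets borel"
  by (simp add: std_normal_vec_def)

lemma (in prob_space) mutual_information_eq_awgn_information:
  fixes X :: "'a \<Rightarrow> real ^ 'n" and Z :: "'a \<Rightarrow> real ^ 'n"
  assumes f: "f \<in> borel_measurable borel"
    and ind: "indep_var borel X borel Z"
    and Z: "distr M borel Z = std_normal_vec"
  shows "mutual_information b borel borel X (\<lambda>\<omega>. f (X \<omega>) + Z \<omega>)
       = awgn_information b f (distr M borel X)"
proof -
  note [measurable] = f
  have [measurable]: "X \<in> borel_measurable M" "Z \<in> borel_measurable M"
    using ind by (auto dest: indep_var_rv1 indep_var_rv2)
  let ?L = "distr M borel X \<Otimes>\<^sub>M (std_normal_vec :: (real ^ 'n) measure)"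
  have L: "?L = distr M (borel \<Otimes>\<^sub>M borel) (\<lambda>x. (X x, Z x))"
    using ind unfolding indep_var_distribution_eq Z by simp
  have "prob_space ?L" unfolding L by (rule prob_space_distr) measurable
  then interpret L: prob_space ?L .
  show ?thesis
    unfolding awgn_information_def L.mutual_information_def mutual_information_def
    unfolding L by (subst (1 2 3) distr_distr) (simp_all add: comp_def)
qed

text \<open>
  Since \<open>x / 0 = 0\<close> in HOL, a zero radius drops the corresponding summand, and the coordinate
  has to be forced to \<open>0\<close> explicitly.
\<close>

definition ellipse :: "real \<Rightarrow> real \<Rightarrow> (real ^ 2) set" where
  "ellipse rp rm = {x. (x $ 1)\<^sup>2 / rp\<^sup>2 + (x $ 2)\<^sup>2 / rm\<^sup>2 \<le> 1
      \<and> (rp = 0 \<longrightarrow> x $ 1 = 0) \<and> (rm = 0 \<longrightarrow> x $ 2 = 0)}"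

definition input_distributions :: "(real ^ 'n) set \<Rightarrow> (real ^ 'n) measure set" where
  "input_distributions A = {P. prob_space P \<and> sets P = sets borel \<and> (AE x in P. x \<in> A)}"

definition is_maximum :: "real set \<Rightarrow> real \<Rightarrow> bool" where
  "is_maximum S m \<longleftrightarrow> m \<in> S \<and> (\<forall>s\<in>S. s \<le> m)"

text \<open>
  As for every description operator, the defining property of \<open>capacity\<close> is only available once
  the maximum is known to be attained.
\<close>

definition capacity :: "real \<Rightarrow> real \<Rightarrow> real \<Rightarrow> real" where
  "capacity b rp rm =
     (THE m. is_maximum (awgn_information b (\<lambda>x. x) ` input_distributions (ellipse rp rm)) m)"

text \<open>
  The singular values are the nonnegative square roots of the eigenvalues of \<open>H\<^sup>T H\<close>, counted
  with multiplicity, i.e. as roots of its characteristic polynomial; here in decreasing order.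
\<close>

definition singular_values :: "real ^ 2 ^ 2 \<Rightarrow> real \<Rightarrow> real \<Rightarrow> bool" where
  "singular_values H s1 s2 \<longleftrightarrow> s1 \<ge> s2 \<and> s2 \<ge> 0 \<and>
     (\<forall>t. det (mat t - transpose H ** H) = (t - s1\<^sup>2) * (t - s2\<^sup>2))"

end

theory Submission
  imports Defs
begin

text \<open>
  Writing \<open>g\<close> for the standard normal density and \<open>q\<close> for the density of the output, the mutual
  information is the integral of \<open>g (y - f x) log (g (y - f x) / q y)\<close> against \<open>P \<Otimes> lborel\<close>. It depends
  only on the law of \<open>f X\<close>, and it is invariant under rotations of that law. Hence the singular value
  decomposition of \<open>H\<close>, which maps laws on the disc onto rotated laws on the ellipse, makes the sets of
  attainable values of both problems equal.

  The maximum is attained by compactness: on a bounded set of inputs the integrand, averaged over the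
  input, is dominated by a multiple of \<open>exp (- norm y ^ 2 / 8)\<close>, so the information is weakly
  continuous. Weak sequential compactness in the plane is reduced to Helly's theorem on the line: a
  space-filling curve has a Borel section, so laws on a square are images of laws on an interval under
  a continuous map.
\<close>

section \<open>Schoenberg's space-filling curve\<close>

text \<open>Binary digits after the point, counted from \<open>k = 0\<close>. The floor form makes
  them Borel in \<open>x\<close> and lets weighted partial sums telescope.\<close>

definition binary_digit :: "nat \<Rightarrow> real \<Rightarrow> real" where
  "binary_digit k x = of_int (\<lfloor>2 ^ Suc k * x\<rfloor> - 2 * \<lfloor>2 ^ k * x\<rfloor>)"

lemma binary_digit_cases: "binary_digit k x = 0 \<or> binary_digit k x = 1"
proof -
  have "\<lfloor>2 * y\<rfloor> - 2 * \<lfloor>y\<rfloor> = 0 \<or> \<lfloor>2 * y\<rfloor> - 2 * \<lfloor>y\<rfloor> = 1" for y :: real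
    by linarith
  from this[of "2 ^ k * x"] show ?thesis
    by (auto simp: binary_digit_def mult.assoc)
qed

text \<open>The partial sum telescopes to \<open>x\<close> rounded down to a multiple of
  \<open>1 / 2 ^ n\<close>. On [0, 1) the integer part, which the series omits, is 0.\<close>

lemma binary_digit_sums:
  assumes "0 \<le> x" "x < 1"
  shows "(\<lambda>k. binary_digit k x / 2 ^ Suc k) sums x"
proof -
  have partial: "(\<Sum>k<n. binary_digit k x / 2 ^ Suc k) = of_int \<lfloor>2 ^ n * x\<rfloor> / 2 ^ n" for n
  proof (induction n)
    case 0
    then show ?case using assms by (simp add: floor_eq_iff)
  next
    case (Suc n)
    then show ?case by (simp add: binary_digit_def field_simps)
  qed
  have "(\<lambda>n. of_int \<lfloor>2 ^ n * x\<rfloor> / 2 ^ n) \<longlonglongrightarrow> x"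
  proof (rule tendsto_sandwich)
    show "(\<lambda>n. x - (1/2) ^ n) \<longlonglongrightarrow> x"
      by (rule tendsto_eq_intros LIMSEQ_power_zero | simp)+
    show "\<forall>\<^sub>F n in sequentially. x - (1/2) ^ n \<le> of_int \<lfloor>2 ^ n * x\<rfloor> / 2 ^ n"
    proof (rule always_eventually, rule allI)
      fix n
      have "(2 ^ n * x - 1) / 2 ^ n \<le> of_int \<lfloor>2 ^ n * x\<rfloor> / 2 ^ n"
        by (intro divide_right_mono) (linarith, simp)
      then show "x - (1/2) ^ n \<le> of_int \<lfloor>2 ^ n * x\<rfloor> / 2 ^ n"
        by (simp add: diff_divide_distrib power_one_over)
    qed
    show "\<forall>\<^sub>F n in sequentially. of_int \<lfloor>2 ^ n * x\<rfloor> / 2 ^ n \<le> x"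
      by (rule always_eventually) (simp add: field_simps)
  qed simp
  then show ?thesis
    unfolding sums_def partial .
qed

text \<open>For a 0-1 sequence, the point of the Cantor set with ternary digits
  \<open>2 * a k\<close>.\<close>

definition cantor_value :: "(nat \<Rightarrow> real) \<Rightarrow> real" where
  "cantor_value a = (\<Sum>k. 2 * a k / 3 ^ Suc k)"

lemma cantor_majorant_sums: "(\<lambda>k. 2 * 1 / 3 ^ Suc k :: real) sums 1"
proof -
  have "(\<lambda>k. 2 / 3 * (1 / 3) ^ k :: real) sums (2 / 3 * (1 / (1 - 1 / 3)))"
    by (intro sums_mult geometric_sums) simp
  then show ?thesis by (simp add: power_one_over field_simps)
qed

context
  fixes a :: "nat \<Rightarrow> real"
  assumes digits: "\<And>k. a k = 0 \<or> a k = 1"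
begin

lemma cantor_term_bounds: "0 \<le> 2 * a k / 3 ^ Suc k" "2 * a k / 3 ^ Suc k \<le> 2 * 1 / 3 ^ Suc k"
  using digits[of k] by auto

lemma summable_cantor: "summable (\<lambda>k. 2 * a k / 3 ^ Suc k)"
  using sums_summable[OF cantor_majorant_sums]
  by (rule summable_comparison_test_ev[rotated])
     (intro always_eventually allI, simp only: real_norm_def abs_of_nonneg cantor_term_bounds)

lemma cantor_value_bounds: "0 \<le> cantor_value a" "cantor_value a \<le> 1"
proof -
  show "0 \<le> cantor_value a"
    unfolding cantor_value_def using cantor_term_bounds(1) by (intro suminf_nonneg summable_cantor)
  have "cantor_value a \<le> (\<Sum>k. 2 * 1 / 3 ^ Suc k)"
    unfolding cantor_value_def
    using cantor_term_bounds(2) cantor_majorant_sums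
    by (intro suminf_le summable_cantor) (auto simp: sums_iff)
  then show "cantor_value a \<le> 1"
    using cantor_majorant_sums by (simp add: sums_iff)
qed

lemma cantor_value_shift: "3 * cantor_value a = 2 * a 0 + cantor_value (\<lambda>k. a (Suc k))"
proof -
  have "cantor_value a = (\<Sum>k. 2 * a (Suc k) / 3 ^ Suc (Suc k)) + 2 * a 0 / 3"
    unfolding cantor_value_def using suminf_split_initial_segment[OF summable_cantor, of 1] by simp
  also have "(\<Sum>k. 2 * a (Suc k) / 3 ^ Suc (Suc k)) = (\<Sum>k. 2 * a (Suc k) / 3 ^ Suc k / 3)"
    by (simp add: field_simps)
  also have "\<dots> = cantor_value (\<lambda>k. a (Suc k)) / 3"
  proof -
    have "summable (\<lambda>k. 2 * a (Suc k) / 3 ^ Suc (Suc k))"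
      using summable_cantor summable_Suc_iff[of "\<lambda>k. 2 * a k / 3 ^ Suc k"] by simp
    then have "summable (\<lambda>k. 3 * (2 * a (Suc k) / 3 ^ Suc (Suc k)))"
      by (rule summable_mult)
    then show ?thesis
      unfolding cantor_value_def by (intro suminf_divide) (simp add: field_simps)
  qed
  finally show ?thesis by simp
qed

end

text \<open>Multiplying by \<open>3 ^ n\<close> moves the first \<open>n\<close> ternary digits in
  front of the point. All of them are even, hence so is the integer they form, and a wave of period
  2 does not see it.\<close>

lemma cantor_value_power:
  assumes "\<And>k. a k = 0 \<or> a k = 1"
  shows "\<exists>m::int. 3 ^ n * cantor_value a = 2 * of_int m + cantor_value (\<lambda>k. a (k + n))"
proof (induction n)
  case 0
  show ?case by (intro exI[of _ 0]) simp
next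
  case (Suc n)
  then obtain m :: int where m: "3 ^ n * cantor_value a = 2 * of_int m + cantor_value (\<lambda>k. a (k + n))"
    by auto
  obtain d :: int where d: "a n = of_int d"
    using assms[of n] by (metis of_int_0 of_int_1)
  have "3 ^ Suc n * cantor_value a = 2 * of_int (3 * m + d) + cantor_value (\<lambda>k. a (k + Suc n))"
    using m cantor_value_shift[of "\<lambda>k. a (k + n)"] assms d by simp
  then show ?case by blast
qed

text \<open>
  The wave is constantly \<open>0\<close> on \<open>[0, 1/3]\<close> and \<open>1\<close> on \<open>[2/3, 1]\<close>, so at a point of the Cantor set it
  reads off the leading ternary digit (halved).
\<close>

definition schoenberg_wave :: "real \<Rightarrow> real" where
  "schoenberg_wave t = max 0 (min 1 (1 / 2 - cos (pi * t)))"

lemma schoenberg_wave_periodic: "schoenberg_wave (2 * of_int m + t) = schoenberg_wave t"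
proof -
  have "cos (pi * (2 * of_int m + t)) = cos (pi * t + 2 * pi * of_int m)"
    by (simp add: algebra_simps)
  also have "\<dots> = cos (pi * t)"
    unfolding cos_add by (simp add: cos_int_2pin sin_int_2pin)
  finally show ?thesis by (simp add: schoenberg_wave_def)
qed

lemma schoenberg_wave_cantor_value_0:
  assumes "\<And>k. a k = 0 \<or> a k = 1"
  shows "schoenberg_wave (cantor_value a) = a 0"
proof -
  let ?t = "cantor_value (\<lambda>k. a (Suc k))"
  have v: "cantor_value a = (2 * a 0 + ?t) / 3"
    using cantor_value_shift[of a] assms by simp
  have t: "0 \<le> ?t" "?t \<le> 1"
    using cantor_value_bounds[of "\<lambda>k. a (Suc k)"] assms by auto
  show ?thesis
  proof (cases "a 0 = 0")
    case True
    have "cos (pi * (?t / 3)) \<ge> cos (pi / 3)"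
      by (rule cos_monotone_0_pi_le) (use t in \<open>auto simp: field_simps\<close>)
    then show ?thesis
      using True by (simp add: schoenberg_wave_def v cos_60)
  next
    case False
    then have a: "a 0 = 1" using assms[of 0] by auto
    have "cos (pi * ((2 + ?t) / 3)) \<le> cos (2 * pi / 3)"
      by (rule cos_monotone_0_pi_le) (use t in \<open>auto simp: field_simps\<close>)
    also have "cos (2 * pi / 3) = - 1 / 2"
      by (rule cos_120)
    finally show ?thesis
      using a by (simp add: schoenberg_wave_def v)
  qed
qed

lemma schoenberg_wave_cantor_value:
  assumes "\<And>k. a k = 0 \<or> a k = 1"
  shows "schoenberg_wave (3 ^ n * cantor_value a) = a n"
proof -
  obtain m :: int where "3 ^ n * cantor_value a = 2 * of_int m + cantor_value (\<lambda>k. a (k + n))"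
    using cantor_value_power[of a n] assms by auto
  then show ?thesis
    using schoenberg_wave_cantor_value_0[of "\<lambda>k. a (k + n)"] assms
    by (simp add: schoenberg_wave_periodic)
qed

text \<open>At a Cantor point the series collects the digits in positions \<open>i\<close>,
  \<open>i + 2\<close>, \<open>i + 4\<close> and so on, and reassembles them as a binary expansion.
  The indices 0 and 1 give the two coordinates of the curve.\<close>

definition schoenberg_coordinate :: "nat \<Rightarrow> real \<Rightarrow> real" where
  "schoenberg_coordinate i t = (\<Sum>k. schoenberg_wave (3 ^ (2 * k + i) * t) / 2 ^ Suc k)"

text \<open>The terms are continuous with a geometric bound, so convergence is uniform on the whole
  line. Global continuity later turns test functions on the plane into test functions on the
  line.\<close>

lemma continuous_on_schoenberg_coordinate: "continuous_on UNIV (schoenberg_coordinate i)"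
proof -
  have "uniform_limit UNIV
      (\<lambda>n t. \<Sum>k<n. schoenberg_wave (3 ^ (2 * k + i) * t) / 2 ^ Suc k)
      (schoenberg_coordinate i) sequentially"
    unfolding schoenberg_coordinate_def
  proof (rule Weierstrass_m_test)
    show "norm (schoenberg_wave (3 ^ (2 * k + i) * t) / 2 ^ Suc k) \<le> (1 / 2) ^ Suc k" for k t
      by (simp add: schoenberg_wave_def power_one_over divide_simps del: power_Suc)
    show "summable (\<lambda>k. (1 / 2 :: real) ^ Suc k)"
      using sums_summable[OF power_half_series] .
  qed
  then show ?thesis
    by (rule uniform_limit_theorem[rotated])
       (auto intro!: always_eventually continuous_intros simp: schoenberg_wave_def)
qed

text \<open>A section of the curve: the digits of the two coordinates are interleaved, even
  positions carrying the first. It may jump at dyadic coordinates but is Borel, which suffices for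
  pushing laws forward.\<close>

definition schoenberg_parameter :: "real \<times> real \<Rightarrow> real" where
  "schoenberg_parameter p =
     cantor_value (\<lambda>k. binary_digit (k div 2) (if even k then fst p else snd p))"

lemma schoenberg_parameter_bounds: "0 \<le> schoenberg_parameter p" "schoenberg_parameter p \<le> 1"
  unfolding schoenberg_parameter_def
  by (rule cantor_value_bounds; rule binary_digit_cases)+

lemma borel_measurable_schoenberg_parameter: "schoenberg_parameter \<in> borel_measurable borel"
proof -
  have [measurable]: "(\<lambda>p :: real \<times> real. if even k then fst p else snd p) \<in> borel_measurable borel" for k :: nat
    by (cases "even k") (auto intro!: borel_measurable_continuous_onI continuous_intros)
  show ?thesis
    unfolding schoenberg_parameter_def cantor_value_def binary_digit_def
    by measurable
qed

lemma schoenberg_coordinate_parameter: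
  assumes "0 \<le> x" "x < 1" "0 \<le> y" "y < 1"
  shows "schoenberg_coordinate 0 (schoenberg_parameter (x, y)) = x"
    and "schoenberg_coordinate 1 (schoenberg_parameter (x, y)) = y"
proof -
  have "schoenberg_wave (3 ^ n * schoenberg_parameter (x, y))
      = binary_digit (n div 2) (if even n then x else y)" for n
    unfolding schoenberg_parameter_def
    by (subst schoenberg_wave_cantor_value) (simp_all add: binary_digit_cases)
  then show "schoenberg_coordinate 0 (schoenberg_parameter (x, y)) = x"
    and "schoenberg_coordinate 1 (schoenberg_parameter (x, y)) = y"
    using binary_digit_sums[OF assms(1,2)] binary_digit_sums[OF assms(3,4)]
    by (simp_all add: schoenberg_coordinate_def sums_iff del: power_Suc)
qed

section \<open>Weak sequential compactness in the plane\<close>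

text \<open>The Borel section \<open>s\<close> pushes the laws to the line, Helly's theorem extracts
  a limit there, and \<open>G\<close> carries it back. Convergence on the line is tested only with
  \<open>f\<close> after \<open>G\<close>, which is continuous, so jumps of \<open>s\<close> do no
  harm.\<close>

lemma weakly_convergent_subsequence_compact:
  fixes Q :: "nat \<Rightarrow> (real ^ 2) measure"
  assumes K: "compact K" and Q: "\<And>n. Q n \<in> input_distributions K"
  obtains r Q' where "strict_mono r" "Q' \<in> input_distributions K"
    "\<And>(f :: real ^ 2 \<Rightarrow> real) B. continuous_on UNIV f \<Longrightarrow> (\<And>x. \<bar>f x\<bar> \<le> B) \<Longrightarrow>
       (\<lambda>n. integral\<^sup>L (Q (r n)) f) \<longlonglongrightarrow> integral\<^sup>L Q' f"
proof -
  have prob: "prob_space (Q n)" and sets [measurable_cong, simp]: "sets (Q n) = sets borel"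
    and supp: "AE x in Q n. x \<in> K" for n
    using Q[of n] by (auto simp: input_distributions_def)
  interpret Q: prob_space "Q n" for n by (rule prob)
  \<comment> \<open>An empty \<open>K\<close> carries no probability law. Nonemptiness lets
    \<open>infdist\<close> detect membership below, as the distance to the empty set is 0 by
    convention.\<close>
  have "K \<noteq> {}"
    using supp[of 0] Q.AE_False by auto
  \<comment> \<open>The bound is strict so that the rescaled coordinates stay below 1, where the
    digit expansion is valid.\<close>
  obtain R where "R > 0" and R: "\<And>x. x \<in> K \<Longrightarrow> norm x < R"
    using bounded_pos_less compact_imp_bounded[OF K] by blast
  define s where "s x = schoenberg_parameter ((x $ 1 + R) / (2 * R), (x $ 2 + R) / (2 * R))" for x :: "real ^ 2"
  define G :: "real \<Rightarrow> real ^ 2" where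
    "G t = (\<chi> i. 2 * R * schoenberg_coordinate (if i = 1 then 0 else 1) t - R)" for t
  have Gs: "G (s x) = x" if "x \<in> K" for x
  proof -
    have "\<bar>x $ i\<bar> < R" for i
      using R[OF that] component_le_norm_cart[of x i] by simp
    from this[of 1] this[of 2]
    have "0 \<le> (x $ 1 + R) / (2 * R)" "(x $ 1 + R) / (2 * R) < 1"
      "0 \<le> (x $ 2 + R) / (2 * R)" "(x $ 2 + R) / (2 * R) < 1"
      using \<open>R > 0\<close> by (auto simp: field_simps)
    note * = schoenberg_coordinate_parameter[OF this]
    show ?thesis
      using \<open>R > 0\<close> * by (simp add: vec_eq_iff forall_2 G_def s_def)
  qed
  have s [measurable]: "s \<in> borel_measurable borel"
    unfolding s_def
    by (rule measurable_compose[OF _ borel_measurable_schoenberg_parameter])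
       (intro borel_measurable_continuous_onI continuous_intros, use \<open>R > 0\<close> in auto)
  have contG: "continuous_on UNIV G"
    unfolding G_def
    by (intro continuous_intros continuous_on_vec_lambda continuous_on_schoenberg_coordinate)
  then have [measurable]: "G \<in> borel_measurable borel"
    by (rule borel_measurable_continuous_onI)
  define \<mu> where "\<mu> n = distr (Q n) borel s" for n
  have real_distr: "real_distribution (\<mu> n)" for n
    unfolding \<mu>_def by (rule Q.real_distribution_distr) simp
  have "tight \<mu>"
    unfolding tight_def
  proof (intro conjI allI impI real_distr)
    fix e :: real assume "e > 0"
    \<comment> \<open>The parameter lies in [0, 1]; the left end is lowered to -1 because the
      interval is half-open and must contain 0.\<close>
    have "measure (\<mu> n) {-1<..1} = 1" for n
    proof -
      have "s -` {-1<..1} = UNIV"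
        using schoenberg_parameter_bounds by (fastforce simp: s_def intro: less_le_trans[of "-1" 0])
      then show ?thesis
        unfolding \<mu>_def using Q.prob_space sets_eq_imp_space_eq[OF sets]
        by (subst measure_distr) auto
    qed
    then show "\<exists>a b. a < b \<and> (\<forall>n. 1 - e < measure (\<mu> n) {a<..b})"
      using \<open>e > 0\<close> by (intro exI[of _ "-1"] exI[of _ 1]) auto
  qed
  from tight_imp_convergent_subsubsequence[OF this strict_mono_id]
  obtain r M where r: "strict_mono r" and M: "real_distribution M" and conv: "weak_conv_m (\<mu> \<circ> id \<circ> r) M"
    by auto
  interpret M: real_distribution M by fact
  define Q' where "Q' = distr M borel G"
  interpret Q': prob_space Q'
    unfolding Q'_def by (rule M.prob_space_distr) simp
  have lim: "(\<lambda>n. integral\<^sup>L (Q (r n)) f) \<longlonglongrightarrow> integral\<^sup>L Q' f"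
    if f: "continuous_on UNIV f" and B: "\<And>x. \<bar>f x\<bar> \<le> B" for f :: "real ^ 2 \<Rightarrow> real" and B
  proof -
    have [measurable]: "f \<in> borel_measurable borel"
      using f by (rule borel_measurable_continuous_onI)
    have "(\<lambda>n. \<integral>t. f (G t) \<partial>(\<mu> \<circ> id \<circ> r) n) \<longlonglongrightarrow> (\<integral>t. f (G t) \<partial>M)"
    proof (rule weak_conv_imp_integral_bdd_continuous_conv[OF _ M conv])
      show "isCont (\<lambda>t. f (G t)) x" for x
        using continuous_on_compose2[OF f contG] by (simp add: continuous_on_eq_continuous_at)
    qed (use real_distr B in auto)
    moreover have "(\<integral>t. f (G t) \<partial>(\<mu> \<circ> id \<circ> r) n) = integral\<^sup>L (Q (r n)) f" for n
    proof -
      have "(\<integral>t. f (G t) \<partial>(\<mu> \<circ> id \<circ> r) n) = (\<integral>x. f (G (s x)) \<partial>Q (r n))"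
        unfolding \<mu>_def comp_def id_def by (rule integral_distr) simp_all
      also have "\<dots> = integral\<^sup>L (Q (r n)) f"
        using supp[of "r n"] Gs by (intro integral_cong_AE) auto
      finally show ?thesis .
    qed
    moreover have "(\<integral>t. f (G t) \<partial>M) = integral\<^sup>L Q' f"
      unfolding Q'_def by (rule integral_distr[symmetric]) simp_all
    ultimately show ?thesis by simp
  qed
  have "Q' \<in> input_distributions K"
  proof -
    \<comment> \<open>That the limit law charges only \<open>K\<close> is tested with the distance
      to \<open>K\<close>, cut off at 1 to be bounded: its integral is 0 along the sequence, hence
      in the limit.\<close>
    define d where "d x = min 1 (infdist x K)" for x
    have contd: "continuous_on UNIV d"
      unfolding d_def by (intro continuous_intros)
    have bd: "\<bar>d x\<bar> \<le> 1" and nonneg: "0 \<le> d x" for x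
      by (auto simp: d_def infdist_nonneg)
    have [measurable]: "d \<in> borel_measurable borel"
      using contd by (rule borel_measurable_continuous_onI)
    have [simp, measurable_cong]: "sets Q' = sets borel" by (simp add: Q'_def)
    have "integral\<^sup>L (Q (r n)) d = 0" for n
      using supp[of "r n"] by (intro integral_eq_zero_AE) (auto simp: d_def)
    with lim[OF contd bd] have "integral\<^sup>L Q' d = 0"
      by (simp add: LIMSEQ_const_iff)
    moreover have "integrable Q' d"
      using bd by (intro Q'.integrable_const_bound[of _ 1]) auto
    ultimately have "AE x in Q'. d x = 0"
      using integral_nonneg_eq_0_iff_AE nonneg by blast
    then have "AE x in Q'. x \<in> K"
      using in_closed_iff_infdist_zero[OF compact_imp_closed[OF K] \<open>K \<noteq> {}\<close>]
      by (auto simp: d_def min_def split: if_splits)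
    then show ?thesis
      using Q'.prob_space_axioms by (simp add: input_distributions_def)
  qed
  from that[OF r this lim] show thesis .
qed

section \<open>Mutual information as an integral\<close>

definition gaussian :: "real ^ 'n \<Rightarrow> real" where
  "gaussian z = (\<Prod>i\<in>UNIV. std_normal_density (z $ i))"

definition output_density :: "(real ^ 'n) measure \<Rightarrow> real ^ 'n \<Rightarrow> real" where
  "output_density Q y = (\<integral>x. gaussian (y - x) \<partial>Q)"

lemma gaussian_pos: "0 < gaussian z"
  by (simp add: gaussian_def prod_pos normal_density_pos)

lemma output_density_nonneg: "0 \<le> output_density Q y"
  unfolding output_density_def
  by (intro Bochner_Integration.integral_nonneg less_imp_le gaussian_pos)

lemma prod_Basis_cart:
  fixes F :: "real \<Rightarrow> 'a :: comm_monoid_mult" and x :: "real ^ 'n"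
  shows "(\<Prod>b\<in>Basis. F (x \<bullet> b)) = (\<Prod>i\<in>UNIV. F (x $ i))"
proof -
  have "(Basis :: (real ^ 'n) set) = range (\<lambda>i. axis i 1)"
    by (auto simp: Basis_vec_def)
  moreover have "inj (\<lambda>i::'n. axis i (1::real))"
    by (auto simp: inj_on_def axis_eq_axis)
  ultimately have "(\<Prod>b\<in>Basis. F (x \<bullet> b)) = (\<Prod>i\<in>UNIV. F (x \<bullet> axis i 1))"
    by (subst \<open>Basis = _\<close>, subst prod.reindex) (simp_all add: comp_def)
  then show ?thesis by (simp add: inner_axis)
qed

lemma nn_integral_prod_cart:
  fixes h :: "real \<Rightarrow> real"
  assumes [measurable]: "h \<in> borel_measurable borel" and nn: "\<And>t. 0 \<le> h t"
  shows "(\<integral>\<^sup>+z. ennreal (\<Prod>i\<in>(UNIV::'n::finite set). h (z $ i)) \<partial>lborel) = (\<integral>\<^sup>+t. ennreal (h t) \<partial>lborel) ^ CARD('n)"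
proof -
  have "(\<integral>\<^sup>+z. ennreal (\<Prod>i\<in>(UNIV::'n set). h (z $ i)) \<partial>lborel)
      = (\<integral>\<^sup>+(z :: real ^ 'n). (\<Prod>b\<in>Basis. ennreal (h (z \<bullet> b))) \<partial>lborel)"
    using nn by (simp add: prod_Basis_cart[where F = h, symmetric] prod_ennreal)
  also have "\<dots> = (\<integral>\<^sup>+t. ennreal (h t) \<partial>lborel) ^ CARD('n)"
    by (subst nn_integral_lborel_prod) auto
  finally show ?thesis .
qed

lemma borel_measurable_gaussian [measurable]: "gaussian \<in> borel_measurable borel"
  unfolding gaussian_def normal_density_def
  by (intro borel_measurable_continuous_onI continuous_intros) auto

lemma prob_space_std_normal_vec: "prob_space (std_normal_vec :: (real ^ 'n) measure)"
proof
  have "(\<integral>\<^sup>+t. ennreal (std_normal_density t) \<partial>lborel) = 1"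
    by (subst nn_integral_eq_integral)
       (auto intro: integral_std_normal_moment_even[of 0, simplified])
  then show "emeasure std_normal_vec (space std_normal_vec :: (real ^ 'n) set) = 1"
    by (simp add: std_normal_vec_def emeasure_density nn_integral_prod_cart)
qed

lemma norm_square_cart:
  fixes z :: "real ^ 'n"
  shows "(norm z)\<^sup>2 = (\<Sum>i\<in>UNIV. (z $ i)\<^sup>2)"
  unfolding power2_norm_eq_inner inner_vec_def by (simp add: power2_eq_square)

lemma gaussian_eq:
  fixes z :: "real ^ 'n"
  shows "gaussian z = (1 / sqrt (2 * pi)) ^ CARD('n) * exp (- (norm z)\<^sup>2 / 2)"
proof -
  have "exp (- (norm z)\<^sup>2 / 2) = (\<Prod>i\<in>UNIV. exp (- (z $ i)\<^sup>2 / 2))"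
    unfolding norm_square_cart by (simp add: sum_negf sum_divide_distrib flip: exp_sum)
  then show ?thesis
    by (simp add: gaussian_def normal_density_def prod_dividef power_one_over)
qed

lemma integrable_exp_norm_square:
  "integrable lborel (\<lambda>y :: real ^ 'n. exp (- (norm y)\<^sup>2 / 8))"
proof (rule integrableI_nonneg)
  have *: "exp (- (norm y)\<^sup>2 / 8) = (\<Prod>i\<in>UNIV. exp (- (y $ i)\<^sup>2 / 8))" for y :: "real ^ 'n"
    unfolding norm_square_cart by (simp add: sum_negf sum_divide_distrib flip: exp_sum)
  \<comment> \<open>The exponent is that of a normal density with standard deviation 2, since
    \<open>2 * 2^2 = 8\<close>.\<close>
  have "exp (- t\<^sup>2 / 8) = sqrt (8 * pi) * normal_density 0 2 t" for t :: real
    by (simp add: normal_density_def)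
  moreover have "integrable lborel (normal_density 0 2)"
    by simp
  ultimately have "integrable lborel (\<lambda>t :: real. exp (- t\<^sup>2 / 8))"
    by simp
  then have "(\<integral>\<^sup>+(t :: real). ennreal (exp (- t\<^sup>2 / 8)) \<partial>lborel) < \<infinity>"
    by (simp add: integrable_iff_bounded)
  then show "(\<integral>\<^sup>+(y :: real ^ 'n). ennreal (exp (- (norm y)\<^sup>2 / 8)) \<partial>lborel) < \<infinity>"
    unfolding * by (subst nn_integral_prod_cart) (auto simp: power_less_top_ennreal)
qed auto

locale awgn_input = prob_space Q for Q :: "(real ^ 'n) measure" +
  assumes sets_Q [simp, measurable_cong]: "sets Q = sets borel"
begin

lemma space_Q [simp]: "space Q = UNIV"
  using sets_eq_imp_space_eq[OF sets_Q] by simp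

lemma integrable_gaussian: "integrable Q (\<lambda>x. gaussian (y - x))"
proof (rule integrable_const_bound)
  show "AE x in Q. norm (gaussian (y - x)) \<le> (1 / sqrt (2 * pi)) ^ CARD('n)"
    unfolding gaussian_eq by (simp add: mult_le_cancel_left1)
qed measurable

lemma borel_measurable_output_density [measurable]: "output_density Q \<in> borel_measurable borel"
  unfolding output_density_def by measurable

lemma nn_integral_gaussian: "(\<integral>\<^sup>+x. ennreal (gaussian (y - x)) \<partial>Q) = ennreal (output_density Q y)"
  unfolding output_density_def
  using integrable_gaussian gaussian_pos by (intro nn_integral_eq_integral) (auto intro: less_imp_le)

lemma awgn_input_distr:
  assumes "f \<in> borel_measurable borel"
  shows "awgn_input (distr Q borel f)"
proof -
  have "prob_space (distr Q borel f)"
    using assms by (intro prob_space_distr) simp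
  then show ?thesis by (simp add: awgn_input_def awgn_input_axioms_def)
qed

text \<open>With \<open>Q\<close> itself as reference measure the input has density 1, even if its
  law is discrete or singular. The joint density relative to \<open>Q\<close> and Lebesgue measure
  is the shifted Gaussian, and the output density is its marginal. A change of variables then leaves
  a formula in the law of \<open>f X\<close> alone.\<close>

lemma awgn_information_eq_integral:
  assumes b: "1 < b" and f [measurable]: "f \<in> borel_measurable borel"
  defines "Q' \<equiv> distr Q borel f"
  shows "awgn_information b f Q =
    (\<integral>(x, y). gaussian (y - x) * log b (gaussian (y - x) / output_density Q' y) \<partial>(Q' \<Otimes>\<^sub>M lborel))"
proof -
  interpret Q': awgn_input Q'
    unfolding Q'_def by (rule awgn_input_distr) fact
  interpret N: prob_space "std_normal_vec :: (real ^ 'n) measure"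
    by (rule prob_space_std_normal_vec)
  interpret L: pair_prob_space Q "std_normal_vec :: (real ^ 'n) measure" ..
  interpret L: information_space "Q \<Otimes>\<^sub>M (std_normal_vec :: (real ^ 'n) measure)" b
    by standard (rule b)
  let ?L = "Q \<Otimes>\<^sub>M (std_normal_vec :: (real ^ 'n) measure)"
  let ?X = "\<lambda>(x, z :: real ^ 'n). x" and ?Y = "\<lambda>(x, z). f x + z"
  have distr_fst: "distr ?L Q ?X = Q"
    using N.distr_pair_fst[of Q] by (simp add: case_prod_beta')
  have X: "distributed ?L Q ?X (\<lambda>x. ennreal 1)"
    unfolding distributed_def distr_fst by (simp add: density_1)
  have XY: "distributed ?L (Q \<Otimes>\<^sub>M lborel) (\<lambda>p. (?X p, ?Y p)) (\<lambda>(x, y). ennreal (gaussian (y - f x)))"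
    unfolding distributed_def
  proof safe
    show "distr ?L (Q \<Otimes>\<^sub>M lborel) (\<lambda>p. (?X p, ?Y p))
        = density (Q \<Otimes>\<^sub>M lborel) (\<lambda>(x, y). ennreal (gaussian (y - f x)))" (is "?l = ?r")
    proof (rule measure_eqI)
      fix A assume "A \<in> sets ?l"
      then have A: "A \<in> sets (Q \<Otimes>\<^sub>M lborel)" by (simp only: sets_distr)
      moreover have "sets (Q \<Otimes>\<^sub>M lborel) = sets (borel \<Otimes>\<^sub>M (borel :: (real ^ 'n) measure))"
        by (intro sets_pair_measure_cong) simp_all
      ultimately have [measurable]: "A \<in> sets (borel \<Otimes>\<^sub>M borel)" by simp
      have "emeasure ?l A = (\<integral>\<^sup>+p. indicator A (?X p, ?Y p) \<partial>?L)"
        using A by (subst nn_integral_indicator[symmetric], simp only: sets_distr)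
          (rule nn_integral_distr, measurable)
      also have "\<dots> = (\<integral>\<^sup>+x. \<integral>\<^sup>+z. indicator A (x, f x + z) \<partial>std_normal_vec \<partial>Q)"
        by (subst N.nn_integral_fst[symmetric]) (simp_all add: case_prod_beta')
      also have "\<dots> = (\<integral>\<^sup>+x. \<integral>\<^sup>+z. ennreal (gaussian (f x + z - f x)) * indicator A (x, f x + z) \<partial>lborel \<partial>Q)"
        unfolding std_normal_vec_def gaussian_def[symmetric]
        by (intro nn_integral_cong) (subst nn_integral_density, simp_all)
      also have "\<dots> = (\<integral>\<^sup>+x. \<integral>\<^sup>+y. ennreal (gaussian (y - f x)) * indicator A (x, y) \<partial>lborel \<partial>Q)"
      proof (rule nn_integral_cong)
        fix x
        show "(\<integral>\<^sup>+z. ennreal (gaussian (f x + z - f x)) * indicator A (x, f x + z) \<partial>lborel)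
            = (\<integral>\<^sup>+y. ennreal (gaussian (y - f x)) * indicator A (x, y) \<partial>lborel)"
          by (subst (2) lborel_distr_plus[of "f x", symmetric]) (subst nn_integral_distr, simp_all)
      qed
      also have "\<dots> = (\<integral>\<^sup>+p. (case p of (x, y) \<Rightarrow> ennreal (gaussian (y - f x))) * indicator A p \<partial>(Q \<Otimes>\<^sub>M lborel))"
        by (subst lborel.nn_integral_fst[symmetric]) simp_all
      also have "\<dots> = emeasure ?r A"
        by (subst emeasure_density) simp_all
      finally show "emeasure ?l A = emeasure ?r A" .
    qed simp
  qed measurable
  have od: "(\<integral>\<^sup>+x. ennreal (gaussian (y - f x)) \<partial>Q) = ennreal (output_density Q' y)" for y
    unfolding Q'.nn_integral_gaussian[symmetric] unfolding Q'_def by (subst nn_integral_distr) simp_all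
  have Y: "distributed ?L lborel ?Y (\<lambda>y. ennreal (output_density Q' y))"
    using L.distr_marginal2[OF _ _ XY] by (simp add: od sigma_finite_measure_axioms sigma_finite_lborel)
  \<comment> \<open>Only the sigma-algebras of the target measures enter mutual information, so
    \<open>borel\<close> may be exchanged for \<open>Q\<close> and \<open>lborel\<close>.\<close>
  have "awgn_information b f Q = L.mutual_information b Q lborel ?X ?Y"
    unfolding awgn_information_def L.mutual_information_def
    by (intro arg_cong2[where f = "KL_divergence b"] arg_cong2[where f = "(\<Otimes>\<^sub>M)"] distr_cong sets_pair_measure_cong) auto
  also have "\<dots> = (\<integral>p. (case p of (x, y) \<Rightarrow> gaussian (y - f x)) *
      log b ((case p of (x, y) \<Rightarrow> gaussian (y - f x)) / (1 * output_density Q' (snd p))) \<partial>(Q \<Otimes>\<^sub>M lborel))"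
  proof (rule L.mutual_information_distr[OF sigma_finite_measure_axioms sigma_finite_lborel X _ Y])
    show "distributed ?L (Q \<Otimes>\<^sub>M lborel) (\<lambda>p. (?X p, ?Y p)) (\<lambda>p. ennreal (case p of (x, y) \<Rightarrow> gaussian (y - f x)))"
      using XY by (simp add: case_prod_beta')
  qed (auto simp: output_density_nonneg intro: less_imp_le[OF gaussian_pos])
  also have "\<dots> = (\<integral>(x, y). gaussian (y - x) * log b (gaussian (y - x) / output_density Q' y)
      \<partial>distr (Q \<Otimes>\<^sub>M lborel) (borel \<Otimes>\<^sub>M lborel) (\<lambda>(x, y). (f x, y)))"
    by (subst integral_distr) (simp_all add: case_prod_beta')
  also have "distr (Q \<Otimes>\<^sub>M lborel) (borel \<Otimes>\<^sub>M lborel) (\<lambda>(x, y :: real ^ 'n). (f x, y)) = Q' \<Otimes>\<^sub>M lborel"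
  proof -
    have id: "distr lborel lborel (\<lambda>x. x) = (lborel :: (real ^ 'n) measure)"
      by (rule distr_id2) simp
    have "distr Q borel f \<Otimes>\<^sub>M distr lborel lborel (\<lambda>x. x :: real ^ 'n)
        = distr (Q \<Otimes>\<^sub>M lborel) (borel \<Otimes>\<^sub>M lborel) (\<lambda>(x, y). (f x, y))"
      by (rule pair_measure_distr) (simp_all add: id sigma_finite_lborel)
    then show ?thesis by (simp add: id Q'_def)
  qed
  finally show ?thesis .
qed

text \<open>The integral formula sees only the law of \<open>f X\<close>. This covers a
  noninvertible \<open>f\<close>: what it discards about the input does not influence the
  output.\<close>

lemma awgn_information_distr:
  assumes b: "1 < b" and f [measurable]: "f \<in> borel_measurable borel"
  shows "awgn_information b f Q = awgn_information b (\<lambda>x. x) (distr Q borel f)"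
proof -
  interpret Q': awgn_input "distr Q borel f"
    by (rule awgn_input_distr) fact
  have "distr (distr Q borel f) borel (\<lambda>x. x) = distr Q borel f"
    by (rule distr_id2) simp
  then show ?thesis
    using Q'.awgn_information_eq_integral[OF b, of "\<lambda>x. x"] awgn_information_eq_integral[OF b f] by simp
qed

end

section \<open>Weak continuity on bounded inputs\<close>

definition awgn_integrand :: "real \<Rightarrow> (real ^ 'n) measure \<Rightarrow> real ^ 'n \<Rightarrow> real ^ 'n \<Rightarrow> real" where
  "awgn_integrand b Q x y = gaussian (y - x) * log b (gaussian (y - x) / output_density Q y)"

abbreviation (input) gaussian_const :: "'n::finite itself \<Rightarrow> real" where
  "gaussian_const n \<equiv> (1 / sqrt (2 * pi)) ^ CARD('n)"

lemma norm_add_square_le: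
  fixes x y :: "'a :: real_inner"
  shows "(norm (x + y))\<^sup>2 \<le> 2 * (norm x)\<^sup>2 + 2 * (norm y)\<^sup>2"
proof -
  have "(norm (x + y))\<^sup>2 + (norm (x - y))\<^sup>2 = 2 * (norm x)\<^sup>2 + 2 * (norm y)\<^sup>2"
    by (simp add: power2_norm_eq_inner inner_simps)
  then show ?thesis by (smt (verit) zero_le_power2)
qed

text \<open>The parallelogram law compares \<open>norm (y - x)\<close> with \<open>norm y\<close> at
  the cost of a factor 2. With the companion lower bound this is uniform over inputs in the ball, so
  it survives averaging into the output density.\<close>

lemma gaussian_shift_upper:
  fixes x y :: "real ^ 'n"
  assumes "norm x \<le> R"
  shows "gaussian (y - x) \<le> gaussian_const TYPE('n) * exp (R\<^sup>2 / 2 - (norm y)\<^sup>2 / 4)"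
proof -
  have "(norm x)\<^sup>2 \<le> R\<^sup>2" using assms by (intro power_mono) auto
  moreover have "(norm y)\<^sup>2 \<le> 2 * (norm (y - x))\<^sup>2 + 2 * (norm x)\<^sup>2"
    using norm_add_square_le[of "y - x" x] by simp
  ultimately show ?thesis
    unfolding gaussian_eq by (intro mult_left_mono) (auto simp: field_simps)
qed

lemma gaussian_shift_lower:
  fixes x y :: "real ^ 'n"
  assumes "norm x \<le> R"
  shows "gaussian_const TYPE('n) * exp (- R\<^sup>2 - (norm y)\<^sup>2) \<le> gaussian (y - x)"
proof -
  have "(norm x)\<^sup>2 \<le> R\<^sup>2" using assms by (intro power_mono) auto
  moreover have "(norm (y - x))\<^sup>2 \<le> 2 * (norm y)\<^sup>2 + 2 * (norm x)\<^sup>2"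
    using norm_add_square_le[of y "- x"] by simp
  ultimately show ?thesis
    unfolding gaussian_eq by (intro mult_left_mono) (auto simp: field_simps)
qed

text \<open>Half of the exponential decay is spent on absorbing the linear factor, via
  \<open>s / 8 \<le> exp (s / 8)\<close>.\<close>

lemma mult_exp_minus_le:
  fixes a s :: real
  assumes "0 \<le> a" "0 \<le> s"
  shows "(a + s) * exp (- s / 4) \<le> (a + 8) * exp (- s / 8)"
proof -
  have "s / 8 \<le> exp (s / 8)" using exp_ge_add_one_self[of "s / 8"] by linarith
  moreover have "1 \<le> exp (s / 8)" using assms by simp
  then have "a * 1 \<le> a * exp (s / 8)" using assms by (intro mult_left_mono) auto
  ultimately have "a + s \<le> (a + 8) * exp (s / 8)" by (simp add: algebra_simps)
  then have "(a + s) * exp (- s / 4) \<le> (a + 8) * exp (s / 8) * exp (- s / 4)"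
    by (intro mult_right_mono) auto
  also have "\<dots> = (a + 8) * exp (- s / 8)"
    by (simp add: mult.assoc flip: exp_add)
  finally show ?thesis .
qed

lemma abs_ln_diff_le:
  fixes u v :: real
  assumes "0 < l" "l \<le> u" "u \<le> h" "l \<le> v" "v \<le> h"
  shows "\<bar>ln u - ln v\<bar> \<le> ln h - ln l"
proof -
  have "ln l \<le> ln u" "ln u \<le> ln h" "ln l \<le> ln v" "ln v \<le> ln h"
    using assms by auto
  then show ?thesis by linarith
qed

text \<open>The constants combine the upper Gaussian bound, the bound \<open>3 / 2 * R^2 + s\<close>
  for the log-ratio of the densities with \<open>s\<close> the squared norm, and the 8 from
  \<open>mult_exp_minus_le\<close>. Depending on the input law only through \<open>R\<close>, it
  dominates a whole sequence of laws at once.\<close>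

definition awgn_majorant :: "real \<Rightarrow> real \<Rightarrow> real ^ 'n \<Rightarrow> real" where
  "awgn_majorant b R y = gaussian_const TYPE('n) * exp (R\<^sup>2 / 2) * (3 / 2 * R\<^sup>2 + 8) / ln b * exp (- (norm y)\<^sup>2 / 8)"

lemma integrable_awgn_majorant: "integrable lborel (awgn_majorant b R)"
  unfolding awgn_majorant_def by (intro integrable_mult_right integrable_exp_norm_square)

locale bounded_awgn_input = awgn_input Q for Q :: "(real ^ 'n) measure" +
  fixes R :: real
  assumes bounded_support: "AE x in Q. norm x \<le> R"
begin

lemma output_density_upper:
  "output_density Q y \<le> gaussian_const TYPE('n) * exp (R\<^sup>2 / 2 - (norm y)\<^sup>2 / 4)"
  unfolding output_density_def
  using bounded_support gaussian_shift_upper by (intro integral_le_const integrable_gaussian) auto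

lemma output_density_lower:
  "gaussian_const TYPE('n) * exp (- R\<^sup>2 - (norm y)\<^sup>2) \<le> output_density Q y"
  unfolding output_density_def
  using bounded_support gaussian_shift_lower by (intro integral_ge_const integrable_gaussian) auto

lemma output_density_pos: "0 < output_density Q y"
  by (rule less_le_trans[OF _ output_density_lower]) simp

lemma awgn_integrand_bound:
  assumes b: "1 < b" and x: "norm x \<le> R"
  shows "\<bar>awgn_integrand b Q x y\<bar> \<le> awgn_majorant b R y"
proof -
  let ?c = "gaussian_const TYPE('n)"
  let ?l = "?c * exp (- R\<^sup>2 - (norm y)\<^sup>2)" and ?h = "?c * exp (R\<^sup>2 / 2 - (norm y)\<^sup>2 / 4)"
  let ?s = "(norm y)\<^sup>2"
  have c: "0 < ?c" by simp
  have "\<bar>ln (gaussian (y - x)) - ln (output_density Q y)\<bar> \<le> ln ?h - ln ?l"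
    using x by (intro abs_ln_diff_le gaussian_shift_upper gaussian_shift_lower
      output_density_upper output_density_lower) simp
  also have "\<dots> = 3 / 2 * R\<^sup>2 + 3 / 4 * ?s"
    using c by (simp only: ln_mult exp_gt_zero ln_exp) (simp add: field_simps)
  also have "\<dots> \<le> 3 / 2 * R\<^sup>2 + ?s" by simp
  finally have ln: "\<bar>ln (gaussian (y - x)) - ln (output_density Q y)\<bar> \<le> 3 / 2 * R\<^sup>2 + ?s" .
  have "\<bar>awgn_integrand b Q x y\<bar> = gaussian (y - x) * \<bar>ln (gaussian (y - x)) - ln (output_density Q y)\<bar> / ln b"
    using b gaussian_pos[of "y - x"] output_density_pos[of y]
    by (simp add: awgn_integrand_def log_def ln_div abs_mult)
  also have "\<dots> \<le> ?h * (3 / 2 * R\<^sup>2 + ?s) / ln b"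
    using b ln gaussian_shift_upper[OF x]
    by (intro divide_right_mono mult_mono) auto
  also have "\<dots> = ?c * exp (R\<^sup>2 / 2) * ((3 / 2 * R\<^sup>2 + ?s) * exp (- ?s / 4)) / ln b"
    by (simp only: diff_conv_add_uminus exp_add minus_divide_left) (simp only: ac_simps)
  also have "\<dots> \<le> ?c * exp (R\<^sup>2 / 2) * ((3 / 2 * R\<^sup>2 + 8) * exp (- ?s / 8)) / ln b"
    using b by (intro divide_right_mono mult_left_mono mult_exp_minus_le) auto
  also have "\<dots> = awgn_majorant b R y"
    by (simp add: awgn_majorant_def)
  finally show ?thesis .
qed

lemma borel_measurable_awgn_integrand [measurable]:
  "(\<lambda>(x, y). awgn_integrand b Q x y) \<in> borel_measurable (borel \<Otimes>\<^sub>M borel)"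
  unfolding awgn_integrand_def by measurable

lemma AE_awgn_integrand_bound:
  assumes "1 < b"
  shows "AE x in Q. norm (awgn_integrand b Q x y) \<le> awgn_majorant b R y"
  using bounded_support awgn_integrand_bound[OF assms] by auto

lemma integrable_awgn_integrand:
  assumes "1 < b"
  shows "integrable Q (\<lambda>x. awgn_integrand b Q x y)"
  by (rule integrable_const_bound[OF AE_awgn_integrand_bound[OF assms]]) measurable

lemma awgn_integrand_integral_bound:
  assumes "1 < b"
  shows "norm (\<integral>x. awgn_integrand b Q x y \<partial>Q) \<le> awgn_majorant b R y"
proof -
  have "norm (\<integral>x. awgn_integrand b Q x y \<partial>Q) \<le> (\<integral>x. norm (awgn_integrand b Q x y) \<partial>Q)"
    by (rule integral_norm_bound)
  also have "\<dots> \<le> awgn_majorant b R y"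
    by (intro integral_le_const integrable_norm integrable_awgn_integrand AE_awgn_integrand_bound assms)
  finally show ?thesis .
qed

text \<open>Fubini with the output outermost: for fixed \<open>y\<close> the inner integral can be
  followed under weak convergence, and the majorant controls the outer one.\<close>

lemma awgn_information_eq_output_integral:
  assumes b: "1 < b"
  shows "awgn_information b (\<lambda>x. x) Q = (\<integral>y. (\<integral>x. awgn_integrand b Q x y \<partial>Q) \<partial>lborel)"
proof -
  interpret QL: pair_sigma_finite Q lborel ..
  have maj [measurable]: "awgn_majorant b R \<in> borel_measurable borel"
    unfolding awgn_majorant_def by measurable
  have "integrable (Q \<Otimes>\<^sub>M lborel) (\<lambda>(x, y). awgn_integrand b Q x y)"
  proof (rule Bochner_Integration.integrable_bound)
    show "integrable (Q \<Otimes>\<^sub>M lborel) (\<lambda>(x, y). awgn_majorant b R y)"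
      by (rule QL.Fubini_integrable) (auto simp: integrable_awgn_majorant)
    show "AE p in Q \<Otimes>\<^sub>M lborel. norm (case p of (x, y) \<Rightarrow> awgn_integrand b Q x y)
        \<le> norm (case p of (x, y) \<Rightarrow> awgn_majorant b R y)"
    proof (rule QL.AE_pair_measure)
      show "AE x in Q. AE y in lborel. norm (case (x, y) of (x, y) \<Rightarrow> awgn_integrand b Q x y)
          \<le> norm (case (x, y) of (x, y) \<Rightarrow> awgn_majorant b R y)"
        using bounded_support
        by eventually_elim (use awgn_integrand_bound[OF b] in \<open>auto intro!: AE_I2 order_trans[OF _ abs_ge_self]\<close>)
    qed measurable
  qed measurable
  from QL.integral_snd[OF this]
  have "(\<integral>(x, y). awgn_integrand b Q x y \<partial>(Q \<Otimes>\<^sub>M lborel)) = (\<integral>y. (\<integral>x. awgn_integrand b Q x y \<partial>Q) \<partial>lborel)"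
    by simp
  moreover have "distr Q borel (\<lambda>x. x) = Q"
    by (rule distr_id2) simp
  ultimately show ?thesis
    using awgn_information_eq_integral[OF b, of "\<lambda>x. x"] by (simp add: awgn_integrand_def)
qed

end

lemma continuous_on_gaussian [continuous_intros]:
  "continuous_on A f \<Longrightarrow> continuous_on A (\<lambda>x. gaussian (f x))"
  unfolding gaussian_eq by (intro continuous_intros) auto

lemma gaussian_le: "gaussian (z :: real ^ 'n) \<le> gaussian_const TYPE('n)"
  unfolding gaussian_eq by (simp add: mult_le_cancel_left1)

text \<open>Writing the Gaussian as \<open>c * exp (- s)\<close>, its logarithm grows like
  \<open>s\<close>, and \<open>s * exp (- s) \<le> 1\<close>. Boundedness qualifies the product as a
  test function for weak convergence.\<close>

lemma gaussian_ln_bounded: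
  fixes z :: "real ^ 'n"
  defines "c \<equiv> gaussian_const TYPE('n)"
  shows "\<bar>gaussian z * ln (gaussian z)\<bar> \<le> c * (\<bar>ln c\<bar> + 1)"
proof -
  let ?s = "(norm z)\<^sup>2 / 2"
  have c: "0 < c" by (simp add: c_def)
  have g: "gaussian z = c * exp (- ?s)" by (simp add: gaussian_eq c_def)
  have "?s * exp (- ?s) \<le> 1"
    using exp_ge_add_one_self[of ?s] by (simp add: exp_minus field_simps)
  moreover have "exp (- ?s) * \<bar>ln c\<bar> \<le> 1 * \<bar>ln c\<bar>"
    by (intro mult_right_mono) auto
  ultimately have "exp (- ?s) * (\<bar>ln c\<bar> + ?s) \<le> \<bar>ln c\<bar> + 1"
    by (simp add: algebra_simps)
  moreover have "\<bar>ln (gaussian z)\<bar> \<le> \<bar>ln c\<bar> + ?s"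
    unfolding g ln_mult_pos[OF c exp_gt_zero] ln_exp
    using abs_triangle_ineq4[of "ln c" ?s] by simp
  then have "exp (- ?s) * \<bar>ln (gaussian z)\<bar> \<le> exp (- ?s) * (\<bar>ln c\<bar> + ?s)"
    by (intro mult_left_mono) auto
  ultimately have "exp (- ?s) * \<bar>ln (gaussian z)\<bar> \<le> \<bar>ln c\<bar> + 1"
    by (rule order_trans[rotated])
  then have "c * (exp (- ?s) * \<bar>ln (gaussian z)\<bar>) \<le> c * (\<bar>ln c\<bar> + 1)"
    using c by (intro mult_left_mono) auto
  then show ?thesis
    using c by (simp add: g abs_mult mult.assoc)
qed

text \<open>The law enters both as integrating measure and inside the logarithm. Expanding the
  logarithm separates the two: what remains are integrals of fixed bounded continuous functions and
  the scalar function \<open>q * ln q\<close> of the output density.\<close>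

lemma (in bounded_awgn_input) integral_awgn_integrand:
  assumes b: "1 < b"
  shows "(\<integral>x. awgn_integrand b Q x y \<partial>Q)
    = ((\<integral>x. gaussian (y - x) * ln (gaussian (y - x)) \<partial>Q) - output_density Q y * ln (output_density Q y)) / ln b"
proof -
  have "integrable Q (\<lambda>x. gaussian (y - x) * ln (gaussian (y - x)))"
  proof (rule integrable_const_bound)
    show "AE x in Q. norm (gaussian (y - x) * ln (gaussian (y - x)))
        \<le> gaussian_const TYPE('n) * (\<bar>ln (gaussian_const TYPE('n))\<bar> + 1)"
      using gaussian_ln_bounded by (intro AE_I2) (simp only: real_norm_def)
  qed measurable
  then have "(\<integral>x. (gaussian (y - x) * ln (gaussian (y - x)) - gaussian (y - x) * ln (output_density Q y)) / ln b \<partial>Q)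
    = ((\<integral>x. gaussian (y - x) * ln (gaussian (y - x)) \<partial>Q) - output_density Q y * ln (output_density Q y)) / ln b"
    using integrable_gaussian by (simp add: output_density_def)
  moreover have "awgn_integrand b Q x y
      = (gaussian (y - x) * ln (gaussian (y - x)) - gaussian (y - x) * ln (output_density Q y)) / ln b" for x
    using b gaussian_pos[of "y - x"] output_density_pos[of y]
    by (simp add: awgn_integrand_def log_def ln_div algebra_simps)
  ultimately show ?thesis by simp
qed

lemma awgn_information_weakly_continuous:
  fixes Q :: "nat \<Rightarrow> (real ^ 'n) measure" and Q' :: "(real ^ 'n) measure"
  assumes b: "1 < b"
    and Q: "\<And>n. bounded_awgn_input (Q n) R" and Q': "bounded_awgn_input Q' R"
    and weak: "\<And>(f :: real ^ 'n \<Rightarrow> real) B. continuous_on UNIV f \<Longrightarrow> (\<And>x. \<bar>f x\<bar> \<le> B) \<Longrightarrow>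
      (\<lambda>n. integral\<^sup>L (Q n) f) \<longlonglongrightarrow> integral\<^sup>L Q' f"
  shows "(\<lambda>n. awgn_information b (\<lambda>x. x) (Q n)) \<longlonglongrightarrow> awgn_information b (\<lambda>x. x) Q'"
proof -
  interpret Q: bounded_awgn_input "Q n" R for n by (rule Q)
  interpret Q': bounded_awgn_input Q' R by (rule Q')
  show ?thesis
    unfolding Q.awgn_information_eq_output_integral[OF b] Q'.awgn_information_eq_output_integral[OF b]
  proof (rule integral_dominated_convergence)
    show "AE y in lborel. (\<lambda>n. \<integral>x. awgn_integrand b (Q n) x y \<partial>Q n) \<longlonglongrightarrow> (\<integral>x. awgn_integrand b Q' x y \<partial>Q')"
    proof (rule AE_I2)
      fix y :: "real ^ 'n"
      have "(\<lambda>n. \<integral>x. gaussian (y - x) * ln (gaussian (y - x)) \<partial>Q n)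
          \<longlonglongrightarrow> (\<integral>x. gaussian (y - x) * ln (gaussian (y - x)) \<partial>Q')"
        by (rule weak[OF _ gaussian_ln_bounded])
           (intro continuous_intros, auto simp: gaussian_pos[THEN less_imp_neq[symmetric]])
      moreover have "(\<lambda>n. output_density (Q n) y) \<longlonglongrightarrow> output_density Q' y"
        unfolding output_density_def
        by (rule weak[where B = "gaussian_const TYPE('n)"])
           (intro continuous_intros, simp add: abs_of_pos[OF gaussian_pos] gaussian_le)
      \<comment> \<open>The limit density is strictly positive, so \<open>ln\<close> is continuous
        at it.\<close>
      ultimately show "(\<lambda>n. \<integral>x. awgn_integrand b (Q n) x y \<partial>Q n) \<longlonglongrightarrow> (\<integral>x. awgn_integrand b Q' x y \<partial>Q')"
        unfolding Q.integral_awgn_integrand[OF b] Q'.integral_awgn_integrand[OF b]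
        using b Q'.output_density_pos[of y] by (intro tendsto_intros) auto
    qed
    show "AE y in lborel. norm (\<integral>x. awgn_integrand b (Q n) x y \<partial>Q n) \<le> awgn_majorant b R y" for n
      by (intro AE_I2 Q.awgn_integrand_integral_bound b)
    show "(\<lambda>y. \<integral>x. awgn_integrand b Q' x y \<partial>Q') \<in> borel_measurable lborel"
      by measurable
    show "(\<lambda>y. \<integral>x. awgn_integrand b (Q n) x y \<partial>Q n) \<in> borel_measurable lborel" for n
      by measurable
  qed (rule integrable_awgn_majorant)
qed

section \<open>Rotations and attainment\<close>

lemma borel_measurable_orthogonal:
  fixes f :: "'a::euclidean_space \<Rightarrow> 'a"
  shows "orthogonal_transformation f \<Longrightarrow> f \<in> borel_measurable borel"
  by (intro borel_measurable_continuous_onI linear_continuous_on linear_conv_bounded_linear[THEN iffD1]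
      orthogonal_transformation_linear)

text \<open>Lebesgue measure is determined by the volumes of boxes. The preimage of a box is its
  image under the inverse map, which is again orthogonal and hence preserves volume.\<close>

lemma distr_lborel_orthogonal:
  fixes f :: "real ^ 'n :: {finite, wellorder} \<Rightarrow> real ^ 'n::_"
  assumes f: "orthogonal_transformation f"
  shows "distr lborel borel f = lborel"
proof (rule lborel_eqI[symmetric])
  fix l u :: "real ^ 'n::_"
  assume le: "\<And>b. b \<in> Basis \<Longrightarrow> l \<bullet> b \<le> u \<bullet> b"
  have [measurable]: "f \<in> borel_measurable borel"
    using f by (rule borel_measurable_orthogonal)
  have inv: "orthogonal_transformation (inv f)"
    using f by (rule orthogonal_transformation_inv)
  have vimage: "f -` box l u = inv f ` box l u"
    using orthogonal_transformation_bij[OF f] by (rule bij_vimage_eq_inv_image)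
  have fin: "f -` box l u \<in> lmeasurable"
    unfolding vimage by (intro measurable_orthogonal_image inv lmeasurable_box)
  have [measurable]: "f -` box l u \<in> sets borel"
    using measurable_sets[of f borel borel "box l u"] by simp
  have "emeasure (distr lborel borel f) (box l u) = emeasure lebesgue (f -` box l u)"
    by (simp add: emeasure_distr)
  also have "\<dots> = ennreal (measure lebesgue (f -` box l u))"
    using fin by (rule emeasure_eq_measure2)
  also have "measure lebesgue (f -` box l u) = measure lebesgue (box l u)"
    unfolding vimage by (intro measure_orthogonal_image inv lmeasurable_box)
  also have "\<dots> = (\<Prod>b\<in>Basis. (u - l) \<bullet> b)"
    using le by (simp add: measure_lborel_box)
  finally show "emeasure (distr lborel borel f) (box l u) = (\<Prod>b\<in>Basis. (u - l) \<bullet> b)" .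
qed simp

text \<open>Applying \<open>U\<close> to input and output together changes neither the Gaussian of
  their difference nor Lebesgue measure, and the output density moves along, so the integral formula
  is unchanged.\<close>

lemma awgn_information_orthogonal:
  fixes Q :: "(real ^ 'n :: {finite, wellorder}) measure" and U :: "real ^ 'n::_ \<Rightarrow> real ^ 'n::_"
  assumes "awgn_input Q" and b: "1 < b" and U: "orthogonal_transformation U"
  shows "awgn_information b (\<lambda>x. x) (distr Q borel U) = awgn_information b (\<lambda>x. x) Q"
proof -
  interpret awgn_input Q by fact
  let ?Q' = "distr Q borel U"
  have [measurable]: "U \<in> borel_measurable borel"
    using U by (rule borel_measurable_orthogonal)
  interpret Q': awgn_input ?Q'
    by (rule awgn_input_distr) simp
  have gauss: "gaussian (U y - U x) = gaussian (y - x)" for x y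
  proof -
    have "U y - U x = U (y - x)"
      using U by (simp add: orthogonal_transformation_linear linear_diff)
    then show ?thesis
      using orthogonal_transformation_norm[OF U] by (simp add: gaussian_eq)
  qed
  have od: "output_density ?Q' (U y) = output_density Q y" for y
    unfolding output_density_def by (subst integral_distr) (simp_all add: gauss)
  have "?Q' \<Otimes>\<^sub>M lborel = ?Q' \<Otimes>\<^sub>M distr lborel borel U"
    by (simp add: distr_lborel_orthogonal[OF U])
  also have "\<dots> = distr (Q \<Otimes>\<^sub>M lborel) (borel \<Otimes>\<^sub>M borel) (\<lambda>(x, y). (U x, U y))"
    by (rule pair_measure_distr) (simp_all add: distr_lborel_orthogonal[OF U] sigma_finite_lborel)
  finally have pair: "?Q' \<Otimes>\<^sub>M lborel = distr (Q \<Otimes>\<^sub>M lborel) (borel \<Otimes>\<^sub>M borel) (\<lambda>(x, y). (U x, U y))" .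
  have id: "distr Q borel (\<lambda>x. x) = Q" "distr ?Q' borel (\<lambda>x. x) = ?Q'"
    by (rule distr_id2, simp)+
  have "awgn_information b (\<lambda>x. x) ?Q' =
      (\<integral>(x, y). gaussian (y - x) * log b (gaussian (y - x) / output_density ?Q' y) \<partial>(?Q' \<Otimes>\<^sub>M lborel))"
    using Q'.awgn_information_eq_integral[OF b, of "\<lambda>x. x"] by (simp add: id)
  also have "\<dots> = (\<integral>(x, y). gaussian (y - x) * log b (gaussian (y - x) / output_density Q y) \<partial>(Q \<Otimes>\<^sub>M lborel))"
    unfolding pair by (subst integral_distr) (simp_all add: case_prod_beta' gauss od)
  also have "\<dots> = awgn_information b (\<lambda>x. x) Q"
    using awgn_information_eq_integral[OF b, of "\<lambda>x. x"] by (simp add: id)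
  finally show ?thesis .
qed

section \<open>Attainment of the maximum on compact sets\<close>

lemma (in bounded_awgn_input) awgn_information_bounded:
  assumes b: "1 < b"
  shows "awgn_information b (\<lambda>x. x) Q \<le> integral\<^sup>L lborel (awgn_majorant b R :: real ^ 'n \<Rightarrow> real)"
proof -
  have "norm (awgn_information b (\<lambda>x. x) Q) \<le> integral\<^sup>L lborel (awgn_majorant b R :: real ^ 'n \<Rightarrow> real)"
    unfolding awgn_information_eq_output_integral[OF b]
    by (intro order_trans[OF integral_norm_bound] integral_mono' integrable_awgn_majorant
        awgn_integrand_integral_bound[OF b] order_trans[OF norm_ge_zero awgn_integrand_integral_bound[OF b]])
  then show ?thesis by simp
qed

text \<open>Direct method: laws approaching the supremum have a weakly convergent subsequence, and
  by weak continuity its limit attains the supremum.\<close>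

lemma awgn_information_attains_maximum:
  fixes K :: "(real ^ 2) set"
  assumes K: "compact K" "K \<noteq> {}" and b: "1 < b"
  shows "\<exists>m. is_maximum (awgn_information b (\<lambda>x. x) ` input_distributions K) m"
proof -
  let ?S = "awgn_information b (\<lambda>x. x) ` input_distributions K"
  obtain R where R: "\<And>x. x \<in> K \<Longrightarrow> norm x \<le> R"
    using compact_imp_bounded[OF K(1)] by (auto simp: bounded_iff)
  have input: "bounded_awgn_input Q R" if "Q \<in> input_distributions K" for Q
    using that R by (auto simp: input_distributions_def bounded_awgn_input_def awgn_input_def
      awgn_input_axioms_def bounded_awgn_input_axioms_def)
  have bdd: "bdd_above ?S"
    using bounded_awgn_input.awgn_information_bounded[OF input b] by (auto intro!: bdd_aboveI)
  obtain x where x: "x \<in> K" using K(2) by auto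
  have [measurable]: "K \<in> sets borel"
    using K(1) by (intro borel_closed compact_imp_closed)
  have "return borel x \<in> input_distributions K"
    using x by (auto simp: input_distributions_def prob_space_return AE_return)
  then have "?S \<noteq> {}" by auto
  from closure_contains_Sup[OF this bdd]
  obtain s where s: "\<And>n. s n \<in> ?S" and lim: "s \<longlonglongrightarrow> Sup ?S"
    unfolding closure_sequential by auto
  from s have "\<forall>n. \<exists>Q. Q \<in> input_distributions K \<and> s n = awgn_information b (\<lambda>x. x) Q"
    by auto
  then obtain Q where Q: "\<And>n. Q n \<in> input_distributions K"
    and sQ: "\<And>n. s n = awgn_information b (\<lambda>x. x) (Q n)"
    by metis
  obtain r Q' where r: "strict_mono r" and Q': "Q' \<in> input_distributions K"
    and weak: "\<And>(f :: real ^ 2 \<Rightarrow> real) B. continuous_on UNIV f \<Longrightarrow> (\<And>x. \<bar>f x\<bar> \<le> B) \<Longrightarrow>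
       (\<lambda>n. integral\<^sup>L (Q (r n)) f) \<longlonglongrightarrow> integral\<^sup>L Q' f"
    using weakly_convergent_subsequence_compact[where Q = Q, OF K(1) Q] by metis
  have "(\<lambda>n. awgn_information b (\<lambda>x. x) (Q (r n))) \<longlonglongrightarrow> awgn_information b (\<lambda>x. x) Q'"
  proof (rule awgn_information_weakly_continuous[OF b])
    show "bounded_awgn_input (Q (r n)) R" for n by (intro input Q)
    show "bounded_awgn_input Q' R" by (intro input Q')
  qed (rule weak)
  moreover have "(\<lambda>n. awgn_information b (\<lambda>x. x) (Q (r n))) \<longlonglongrightarrow> Sup ?S"
    using LIMSEQ_subseq_LIMSEQ[OF lim r] by (simp add: comp_def sQ)
  ultimately have "awgn_information b (\<lambda>x. x) Q' = Sup ?S"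
    by (rule LIMSEQ_unique)
  moreover have "awgn_information b (\<lambda>x. x) Q' \<in> ?S"
    using Q' by (rule imageI)
  ultimately show ?thesis
    using bdd unfolding is_maximum_def by (intro exI[of _ "Sup ?S"]) (simp add: cSup_upper)
qed

lemma compact_ellipse: "compact (ellipse rp rm)"
proof -
  have bound: "\<bar>x $ 1\<bar> \<le> \<bar>rp\<bar>" "\<bar>x $ 2\<bar> \<le> \<bar>rm\<bar>" if "x \<in> ellipse rp rm" for x
  proof -
    have e: "(x $ 1)\<^sup>2 / rp\<^sup>2 + (x $ 2)\<^sup>2 / rm\<^sup>2 \<le> 1"
      and z: "rp = 0 \<longrightarrow> x $ 1 = 0" "rm = 0 \<longrightarrow> x $ 2 = 0"
      using that by (auto simp: ellipse_def)
    have "0 \<le> (x $ 1)\<^sup>2 / rp\<^sup>2" "0 \<le> (x $ 2)\<^sup>2 / rm\<^sup>2" by auto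
    then have "(x $ 1)\<^sup>2 / rp\<^sup>2 \<le> 1" "(x $ 2)\<^sup>2 / rm\<^sup>2 \<le> 1" using e by linarith+
    \<comment> \<open>For a zero radius the quotient is 0 and says nothing; the bound then comes
      from the explicit vanishing of the coordinate.\<close>
    then show "\<bar>x $ 1\<bar> \<le> \<bar>rp\<bar>" "\<bar>x $ 2\<bar> \<le> \<bar>rm\<bar>"
      using z by (auto simp: abs_le_square_iff divide_le_eq_1 split: if_splits)
  qed
  have "ellipse rp rm = {x. (x $ 1)\<^sup>2 * inverse (rp\<^sup>2) + (x $ 2)\<^sup>2 * inverse (rm\<^sup>2) \<le> 1}
      \<inter> {x. rp = 0 \<longrightarrow> x $ 1 = 0} \<inter> {x. rm = 0 \<longrightarrow> x $ 2 = 0}"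
    by (auto simp: ellipse_def divide_inverse)
  also have "closed \<dots>"
    by (intro closed_Int closed_Collect_le closed_Collect_imp closed_Collect_eq open_Collect_const
        continuous_intros)
  finally have "closed (ellipse rp rm)" .
  moreover have "bounded (ellipse rp rm)"
  proof (rule boundedI)
    fix x assume "x \<in> ellipse rp rm"
    from bound[OF this] show "norm x \<le> \<bar>rp\<bar> + \<bar>rm\<bar>"
      using norm_le_l1_cart[of x] by (simp add: sum_2)
  qed
  ultimately show ?thesis by (simp add: compact_eq_bounded_closed)
qed

section \<open>Singular value decomposition in the plane\<close>

text \<open>Complex multiplication by \<open>v\<close>: for a unit vector, the rotation taking the
  first axis to \<open>v\<close> and the second to \<open>v\<close> after a quarter turn.\<close>

definition planar_frame :: "real ^ 2 \<Rightarrow> real ^ 2 \<Rightarrow> real ^ 2" where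
  "planar_frame v z = z $ 1 *\<^sub>R v + z $ 2 *\<^sub>R vector [- v $ 2, v $ 1]"

lemma orthogonal_planar_frame:
  assumes "norm v = 1"
  shows "orthogonal_transformation (planar_frame v)"
  unfolding orthogonal_transformation
proof (intro conjI allI)
  show "linear (planar_frame v)"
    by (rule linearI) (simp_all add: planar_frame_def algebra_simps)
  fix z
  have v: "(v $ 1)\<^sup>2 + (v $ 2)\<^sup>2 = 1"
    using assms norm_square_cart[of v] by (simp add: sum_2)
  have "(norm (planar_frame v z))\<^sup>2 = ((v $ 1)\<^sup>2 + (v $ 2)\<^sup>2) * ((z $ 1)\<^sup>2 + (z $ 2)\<^sup>2)"
    unfolding norm_square_cart by (simp add: sum_2 planar_frame_def) algebra
  also have "\<dots> = (norm z)\<^sup>2"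
    unfolding v norm_square_cart by (simp add: sum_2)
  finally show "norm (planar_frame v z) = norm z"
    by simp
qed

lemma exists_singular_vector:
  assumes "singular_values H s1 s2"
  obtains v where "norm v = 1" "(transpose H ** H) *v v = s1\<^sup>2 *\<^sub>R v"
proof -
  let ?A = "mat (s1\<^sup>2) - transpose H ** H"
  have "det ?A = 0"
    using assms by (simp add: singular_values_def)
  then have "\<not> (\<exists>B. B ** ?A = mat 1)"
    by (metis invertible_det_nz invertible_left_inverse)
  then obtain x where x: "?A *v x = 0" "x \<noteq> 0"
    unfolding matrix_left_invertible_ker by auto
  have mat: "mat k *v x = k *\<^sub>R x" for k :: real and x :: "real ^ 2"
    by (simp add: vec_eq_iff forall_2 matrix_vector_mult_def mat_def sum_2)
  have "(transpose H ** H) *v x = s1\<^sup>2 *\<^sub>R x"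
    using x(1) by (simp add: matrix_vector_mult_diff_rdistrib mat)
  then have "(transpose H ** H) *v (x /\<^sub>R norm x) = s1\<^sup>2 *\<^sub>R (x /\<^sub>R norm x)"
    by (simp add: matrix_vector_mult_scaleR)
  then show thesis
    using x(2) by (intro that[of "x /\<^sub>R norm x"]) auto
qed

text \<open>In the plane the orthogonal complement of the unit vector \<open>(p, q)\<close> is the
  line through \<open>(-q, p)\<close>.\<close>

lemma orthogonal_unit_coordinates:
  fixes p q x y :: real
  assumes "p\<^sup>2 + q\<^sup>2 = 1" "p * x + q * y = 0"
  shows "x = - ((y * p - x * q) * q)" "y = (y * p - x * q) * p"
  using assms by algebra+

text \<open>Taking \<open>U\<close> and \<open>V\<close> to be rotations forces the second diagonal entry \<open>c\<close> to carry the sign of \<open>det H\<close>.\<close>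

lemma planar_singular_value_decomposition:
  assumes "singular_values H s1 s2"
  obtains U V :: "real ^ 2 \<Rightarrow> real ^ 2" and c
  where "orthogonal_transformation U" "orthogonal_transformation V" "c\<^sup>2 = s2\<^sup>2"
    "\<And>z. H *v V z = U (vector [s1 * z $ 1, c * z $ 2])"
proof -
  obtain v where v: "norm v = 1" and eig: "(transpose H ** H) *v v = s1\<^sup>2 *\<^sub>R v"
    using exists_singular_vector[OF assms] by blast
  define w :: "real ^ 2" where "w = vector [- v $ 2, v $ 1]"
  have v2: "(v $ 1)\<^sup>2 + (v $ 2)\<^sup>2 = 1"
    using v norm_square_cart[of v] by (simp add: sum_2)
  have inner_H: "(H *v v) \<bullet> (H *v x) = s1\<^sup>2 * (v \<bullet> x)" for x
  proof -
    have "(H *v v) \<bullet> (H *v x) = (transpose H *v (H *v v)) \<bullet> x"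
      by (simp only: dot_lmul_matrix transpose_matrix_vector)
    also have "\<dots> = s1\<^sup>2 * (v \<bullet> x)"
      using eig by (simp add: matrix_vector_mul_assoc)
    finally show ?thesis .
  qed
  have Hv: "(norm (H *v v))\<^sup>2 = s1\<^sup>2"
    using inner_H[of v] v by (simp add: power2_norm_eq_inner[symmetric])
  have orth: "(H *v v) \<bullet> (H *v w) = 0"
    unfolding inner_H by (simp add: w_def inner_vec_def sum_2)
  \<comment> \<open>Since \<open>v\<close> and \<open>w\<close> are orthonormal, the trace of
    \<open>transpose H ** H\<close> fixes the norm of \<open>H *v w\<close> from that of
    \<open>H *v v\<close>.\<close>
  have trace: "(norm (H *v v))\<^sup>2 + (norm (H *v w))\<^sup>2 = s1\<^sup>2 + s2\<^sup>2"
  proof -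
    let ?F = "(H $ 1 $ 1)\<^sup>2 + (H $ 1 $ 2)\<^sup>2 + (H $ 2 $ 1)\<^sup>2 + (H $ 2 $ 2)\<^sup>2"
    have char: "det (mat t - transpose H ** H) = (t - s1\<^sup>2) * (t - s2\<^sup>2)" for t
      using assms by (simp add: singular_values_def)
    \<comment> \<open>\<open>?F\<close> is that trace; the characteristic polynomial is a monic
      quadratic, so its values at 0 and 1 determine it.\<close>
    have "?F = s1\<^sup>2 + s2\<^sup>2"
      using char[of 0] char[of 1]
      by (simp add: det_2 mat_def transpose_def matrix_matrix_mult_def sum_2 power2_eq_square algebra_simps)
    moreover have "(norm (H *v v))\<^sup>2 + (norm (H *v w))\<^sup>2 = ?F * ((v $ 1)\<^sup>2 + (v $ 2)\<^sup>2)"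
      unfolding norm_square_cart
      by (simp add: sum_2 matrix_vector_mult_def w_def power2_eq_square algebra_simps)
    ultimately show ?thesis using v2 by simp
  qed
  have s1: "0 \<le> s1" and s2: "s1 = 0 \<Longrightarrow> s2 = 0"
    using assms by (auto simp: singular_values_def)
  obtain u where u: "norm u = 1" and Hvu: "H *v v = s1 *\<^sub>R u"
  proof (cases "s1 = 0")
    case True
    \<comment> \<open>Here \<open>H *v v = 0\<close>, so any unit vector can serve as
      \<open>u\<close>.\<close>
    then show thesis using that[of v] v Hv by simp
  next
    case False
    have "norm (H *v v) = s1" using Hv s1 by simp
    then show thesis using that[of "H *v v /\<^sub>R s1"] False s1 by simp
  qed
  define u' :: "real ^ 2" where "u' = vector [- u $ 2, u $ 1]"
  have u2: "(u $ 1)\<^sup>2 + (u $ 2)\<^sup>2 = 1"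
    using u norm_square_cart[of u] by (simp add: sum_2)
  define c where "c = (H *v w) \<bullet> u'"
  have "u \<bullet> (H *v w) = 0"
  proof (cases "s1 = 0")
    case True
    \<comment> \<open>\<open>u\<close> was arbitrary in this case, so orthogonality has to come from
      \<open>H *v w = 0\<close>; the trace gives it because \<open>s1 = 0\<close> forces
      \<open>s2 = 0\<close>.\<close>
    then have "H *v w = 0" using trace s2 Hv by simp
    then show ?thesis by simp
  next
    case False
    then show ?thesis using orth Hvu by simp
  qed
  then have "u $ 1 * (H *v w) $ 1 + u $ 2 * (H *v w) $ 2 = 0"
    by (simp add: inner_vec_def sum_2)
  from orthogonal_unit_coordinates[OF u2 this]
  have Hwu: "H *v w = c *\<^sub>R u'"
    unfolding c_def u'_def vec_eq_iff forall_2 inner_vec_def sum_2 by simp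
  have "norm u' = 1"
    using u2 unfolding norm_eq_sqrt_inner inner_vec_def by (simp add: u'_def sum_2 power2_eq_square)
  then have "c\<^sup>2 = s2\<^sup>2"
    using trace Hv by (simp add: Hwu power_mult_distrib)
  moreover have "H *v planar_frame v z = planar_frame u (vector [s1 * z $ 1, c * z $ 2])" for z
    by (simp add: planar_frame_def matrix_vector_right_distrib matrix_vector_mult_scaleR Hvu
        Hwu[unfolded w_def] u'_def mult.commute)
  ultimately show thesis
    using that orthogonal_planar_frame[OF u] orthogonal_planar_frame[OF v] by blast
qed

section \<open>Transport of input laws between disc and ellipse\<close>

lemma input_distributions_distr:
  assumes "P \<in> input_distributions A" and [measurable]: "f \<in> borel_measurable borel"
    and [measurable]: "B \<in> sets borel" and "\<And>x. x \<in> A \<Longrightarrow> f x \<in> B"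
  shows "distr P borel f \<in> input_distributions B"
proof -
  have [measurable_cong, simp]: "sets P = sets borel" and "prob_space P" and "AE x in P. x \<in> A"
    using assms(1) by (auto simp: input_distributions_def)
  have "AE x in P. f x \<in> B"
    using \<open>AE x in P. x \<in> A\<close> by eventually_elim (rule assms(4))
  moreover have "prob_space (distr P borel f)"
    using \<open>prob_space P\<close> by (rule prob_space.prob_space_distr) simp
  ultimately show ?thesis
    by (simp add: input_distributions_def AE_distr_iff)
qed

lemma awgn_input_of_distribution: "P \<in> input_distributions A \<Longrightarrow> awgn_input P"
  by (simp add: input_distributions_def awgn_input_def awgn_input_axioms_def)

text \<open>The decomposition fixes the second radius only up to sign, which the ellipse does not
  see.\<close>

lemma ellipse_cong: "c\<^sup>2 = rm\<^sup>2 \<Longrightarrow> ellipse rp c = ellipse rp rm"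
  using power_eq_0_iff[of c 2] power_eq_0_iff[of rm 2] by (auto simp: ellipse_def)

text \<open>With \<open>H = U D V^-1\<close>, a law on the disc goes to the ellipse by
  \<open>D\<close> after \<open>V^-1\<close>, and a law on the ellipse goes to the disc by
  \<open>V\<close> after \<open>D'\<close>. Both ways the law of \<open>H X\<close> is the
  \<open>U\<close>-image of the ellipse law, so the informations agree.\<close>

lemma awgn_information_image_ball_eq_ellipse:
  fixes H :: "real ^ 2 ^ 2"
  assumes b: "1 < b" and H: "singular_values H s1 s2"
  shows "awgn_information b ((*v) H) ` input_distributions {x. norm x \<le> 1}
       = awgn_information b (\<lambda>x. x) ` input_distributions (ellipse s1 s2)"
proof -
  obtain U V :: "real ^ 2 \<Rightarrow> real ^ 2" and c where U: "orthogonal_transformation U" and V: "orthogonal_transformation V"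
    and c: "c\<^sup>2 = s2\<^sup>2" and HV: "\<And>z. H *v V z = U (vector [s1 * z $ 1, c * z $ 2])"
    using planar_singular_value_decomposition[OF H] by metis
  define D :: "real ^ 2 \<Rightarrow> real ^ 2" where "D z = vector [s1 * z $ 1, c * z $ 2]" for z
  \<comment> \<open>Division by 0 yields 0, so on the ellipse \<open>D'\<close> is a right inverse
    of \<open>D\<close> even when a radius vanishes: the coordinate concerned is 0 there.\<close>
  define D' :: "real ^ 2 \<Rightarrow> real ^ 2" where "D' z = vector [z $ 1 / s1, z $ 2 / c]" for z
  have HV: "H *v V z = U (D z)" for z by (simp add: HV D_def)
  have ell: "ellipse s1 s2 = ellipse s1 c" using ellipse_cong[OF c] by simp
  have V': "orthogonal_transformation (inv V)"
    using V by (rule orthogonal_transformation_inv)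
  have VV': "V (inv V x) = x" for x
    using orthogonal_transformation_surj[OF V] by (simp add: surj_f_inv_f)
  note [measurable] = U[THEN borel_measurable_orthogonal] V[THEN borel_measurable_orthogonal]
    V'[THEN borel_measurable_orthogonal]
  have "linear D"
    by (rule linearI) (simp_all add: D_def vec_eq_iff forall_2 algebra_simps)
  moreover have "linear D'"
    by (rule linearI) (simp_all add: D'_def vec_eq_iff forall_2 add_divide_distrib)
  ultimately have [measurable]: "D \<in> borel_measurable borel" "D' \<in> borel_measurable borel"
    by (auto intro!: borel_measurable_continuous_onI linear_continuous_on linear_conv_bounded_linear[THEN iffD1])
  have [measurable]: "(*v) H \<in> borel_measurable borel"
    by (intro borel_measurable_continuous_onI linear_continuous_on matrix_vector_mul_bounded_linear)
  have ell_borel [measurable]: "ellipse s1 c \<in> sets borel"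
    by (intro borel_closed compact_imp_closed compact_ellipse)
  have ball_borel [measurable]: "{x :: real ^ 2. norm x \<le> 1} \<in> sets borel"
    by (intro borel_closed closed_Collect_le continuous_intros)
  have D_ball: "D z \<in> ellipse s1 c" if "norm z \<le> 1" for z
  proof -
    have "(z $ 1)\<^sup>2 + (z $ 2)\<^sup>2 \<le> 1"
      using power_le_one[OF norm_ge_zero that, of 2] norm_square_cart[of z] by (simp add: sum_2)
    \<comment> \<open>For \<open>k = 0\<close> the left side is 0, hence only an inequality.\<close>
    moreover have "(k * t)\<^sup>2 / k\<^sup>2 \<le> t\<^sup>2" for k t :: real
      by (simp add: power_mult_distrib)
    from this[of s1 "z $ 1"] this[of c "z $ 2"]
    have "(s1 * z $ 1)\<^sup>2 / s1\<^sup>2 + (c * z $ 2)\<^sup>2 / c\<^sup>2 \<le> (z $ 1)\<^sup>2 + (z $ 2)\<^sup>2"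
      by (rule add_mono)
    ultimately show ?thesis by (simp add: ellipse_def D_def)
  qed
  have D'_ellipse: "norm (D' z) \<le> 1" and DD': "D (D' z) = z" if "z \<in> ellipse s1 c" for z
  proof -
    have "(norm (D' z))\<^sup>2 = (z $ 1)\<^sup>2 / s1\<^sup>2 + (z $ 2)\<^sup>2 / c\<^sup>2"
      unfolding norm_square_cart by (simp add: D'_def sum_2 power_divide)
    also have "\<dots> \<le> 1" using that by (simp add: ellipse_def)
    finally show "norm (D' z) \<le> 1" by (simp add: abs_square_le_1)
    show "D (D' z) = z"
      using that by (auto simp: ellipse_def D_def D'_def vec_eq_iff forall_2)
  qed
  show ?thesis
    unfolding ell
  proof (intro equalityI image_subsetI)
    fix P :: "(real ^ 2) measure" assume P: "P \<in> input_distributions {x. norm x \<le> 1}"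
    interpret awgn_input P using P by (rule awgn_input_of_distribution)
    let ?Q = "distr P borel (\<lambda>x. D (inv V x))"
    have Q: "?Q \<in> input_distributions (ellipse s1 c)"
      using P by (rule input_distributions_distr)
        (auto intro!: D_ball simp: orthogonal_transformation_norm[OF V'])
    have "distr P borel ((*v) H) = distr ?Q borel U"
      by (subst distr_distr) (auto simp: comp_def VV' simp flip: HV)
    then have "awgn_information b ((*v) H) P = awgn_information b (\<lambda>x. x) ?Q"
      using awgn_information_distr[OF b, of "(*v) H"]
        awgn_information_orthogonal[OF awgn_input_of_distribution[OF Q] b U] by simp
    then show "awgn_information b ((*v) H) P \<in> awgn_information b (\<lambda>x. x) ` input_distributions (ellipse s1 c)"
      using Q by (rule image_eqI)
  next
    fix Q :: "(real ^ 2) measure" assume Q: "Q \<in> input_distributions (ellipse s1 c)"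
    interpret awgn_input Q using Q by (rule awgn_input_of_distribution)
    let ?P = "distr Q borel (\<lambda>z. V (D' z))"
    have P: "?P \<in> input_distributions {x. norm x \<le> 1}"
      using Q by (rule input_distributions_distr)
        (auto intro!: D'_ellipse simp: orthogonal_transformation_norm[OF V])
    interpret P: awgn_input ?P using P by (rule awgn_input_of_distribution)
    have "distr ?P borel ((*v) H) = distr Q borel (\<lambda>z. U (D (D' z)))"
      by (subst distr_distr) (auto simp: comp_def HV)
    also have "\<dots> = distr Q borel U"
    \<comment> \<open>Almost everywhere only, as \<open>D (D' z) = z\<close> is known just on the
      ellipse.\<close>
    proof (rule distr_cong_AE)
      show "AE z in Q. U (D (D' z)) = U z"
        using Q DD' by (auto simp: input_distributions_def)
    qed auto
    finally have "awgn_information b (\<lambda>x. x) Q = awgn_information b ((*v) H) ?P"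
      using P.awgn_information_distr[OF b, of "(*v) H"]
        awgn_information_orthogonal[OF awgn_input_of_distribution[OF Q] b U] by simp
    then show "awgn_information b (\<lambda>x. x) Q \<in> awgn_information b ((*v) H) ` input_distributions {x. norm x \<le> 1}"
      using P by (rule image_eqI)
  qed
qed

lemma is_maximum_unique: "is_maximum S m \<Longrightarrow> is_maximum S m' \<Longrightarrow> m' = m"
  by (auto simp: is_maximum_def intro: antisym)

theorem mainTheorem1:
  fixes H :: "real ^ 2 ^ 2" and \<sigma>1 \<sigma>2 b :: real
  assumes "b > 1"
    and "singular_values H \<sigma>1 \<sigma>2"
  shows "is_maximum (awgn_information b (\<lambda>x. x) ` input_distributions (ellipse \<sigma>1 \<sigma>2))
           (capacity b \<sigma>1 \<sigma>2)
       \<and> is_maximum (awgn_information b (\<lambda>x. H *v x) ` input_distributions {x. norm x \<le> 1})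
           (capacity b \<sigma>1 \<sigma>2)"
proof -
  have "0 \<in> ellipse \<sigma>1 \<sigma>2" by (simp add: ellipse_def)
  then obtain m where m: "is_maximum (awgn_information b (\<lambda>x. x) ` input_distributions (ellipse \<sigma>1 \<sigma>2)) m"
    using awgn_information_attains_maximum[OF compact_ellipse _ assms(1)] by blast
  \<comment> \<open>A maximum exists and is unique, so the description in \<open>capacity\<close>
    denotes it.\<close>
  then have "is_maximum (awgn_information b (\<lambda>x. x) ` input_distributions (ellipse \<sigma>1 \<sigma>2)) (capacity b \<sigma>1 \<sigma>2)"
    unfolding capacity_def by (rule theI) (rule is_maximum_unique[OF m])
  then show ?thesis
    by (simp add: awgn_information_image_ball_eq_ellipse[OF assms])
qed

end
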